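(* Let $P(z)=a_nz^n+\cdots+a_0$ be a polynomial with real coefficients and $a_n>0$. Define $A(z)=P(e^z)$. Then the number of zeros $n([0,r),f)$ of a nontrivial real solution $f$ of the differential equation $f''+A(z)f=0$ on the interval $[0,r)$ satisfies $n([0,r),f)\ge Ce^{nr/2}$ for some constant $C>0$.
   Context: A real solution is a solution that is real-valued on the real axis. Here $n([0,r),f)$ denotes the number of zeros of $f$ on $[0,r)$, while $n$ in the exponent $nr/2$ is the degree of $P$.
   Formalization: The bound is stated for all sufficiently large r (the threshold and C may depend on P and f); for every r > 0 it fails, e.g. P = 1, f = cos z has no zeros in [0, r) for r ≤ π/2. *)

theory Defs
  imports
    "HOL-Complex_Analysis.Complex_Analysis"
    "HOL-Computational_Algebra.Polynomial"
begin

definition exp_coeff :: "real poly \<Rightarrow> complex \<Rightarrow> complex" where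
  "exp_coeff P z = poly (map_poly complex_of_real P) (exp z)"

definition ode_solution :: "(complex \<Rightarrow> complex) \<Rightarrow> (complex \<Rightarrow> complex) \<Rightarrow> bool" where
  "ode_solution A f \<longleftrightarrow>
     f holomorphic_on UNIV \<and> (\<forall>z. deriv (deriv f) z + A z * f z = 0)"

definition real_solution :: "(complex \<Rightarrow> complex) \<Rightarrow> (complex \<Rightarrow> complex) \<Rightarrow> bool" where
  "real_solution A f \<longleftrightarrow> ode_solution A f \<and> (\<forall>x::real. f (of_real x) \<in> \<real>)"

text \<open>
  Zeros are counted without multiplicity; all zeros of a nontrivial solution of
  a homogeneous second-order linear equation are simple.  For bounded \<open>I\<close> the set is finite for
  an entire function that does not vanish identically, so \<^const>\<open>card\<close> does not
  take its default value in the intended use.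
\<close>

definition zero_count :: "real set \<Rightarrow> (complex \<Rightarrow> complex) \<Rightarrow> nat" where
  "zero_count I f = card {x \<in> I. f (of_real x) = 0}"

end

(* Sturm comparison: if A >= m^2 > 0 on [a, a + pi/m], comparing with sin (m (x - a)) forces a
   zero of f in the half-open interval [a, a + pi/m).  On [r - L, r) one has A >= m^2 with m of
   order exp (n r / 2), and disjoint intervals of length pi/m packed into [r - L, r) give the bound.
   The choice of L makes m L / pi >= 1, so that rounding down costs at most a factor 2; this
   covers n = 0 as well. *)
theory Submission
  imports Defs
begin

text \<open>If there were no zero, \<open>g\<close> or \<open>- g\<close> would be positive at
  \<open>a\<close> and nonnegative up to \<open>a + pi / m\<close>. Its Wronskian with
  \<open>sin (m * (x - a))\<close> would then be nonincreasing, which the values at the two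
  endpoints contradict.\<close>

lemma sturm_comparison_zero:
  fixes g g' q :: "real \<Rightarrow> real"
  assumes m: "m > 0"
    and g: "\<And>x. (g has_real_derivative g' x) (at x)"
    and g': "\<And>x. (g' has_real_derivative - q x * g x) (at x)"
    and q: "\<And>x. a \<le> x \<Longrightarrow> x \<le> a + pi / m \<Longrightarrow> m\<^sup>2 \<le> q x"
  shows "\<exists>x\<in>{a..<a + pi / m}. g x = 0"
proof -
  define b where "b = a + pi / m"
  have ab: "a < b" using m by (simp add: b_def)
  have mb: "m * (b - a) = pi" using m by (simp add: b_def)
  have cont: "isCont h x" if "\<And>x. (h has_real_derivative h' x) (at x)" for h h' :: "real \<Rightarrow> real" and x
    using that DERIV_isCont by blast
  \<comment> \<open>Stated for an arbitrary solution \<open>h\<close>, so that it applies to both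
    \<open>g\<close> and \<open>- g\<close>.\<close>
  have pos: False
    if h: "\<And>x. (h has_real_derivative h' x) (at x)"
      and h': "\<And>x. (h' has_real_derivative - q x * h x) (at x)"
      and nz: "\<And>x. a \<le> x \<Longrightarrow> x < b \<Longrightarrow> h x \<noteq> 0" and "h a > 0" for h h' :: "real \<Rightarrow> real"
  proof -
    \<comment> \<open>Zeros are excluded only on the half-open interval, so at \<open>b\<close>
      nothing stronger than \<open>h b \<ge> 0\<close> can be expected.\<close>
    have nonneg: "h x \<ge> 0" if x: "a \<le> x" "x \<le> b" for x
    proof (rule ccontr)
      assume "\<not> h x \<ge> 0"
      then obtain y where y: "a \<le> y" "y \<le> x" "h y = 0"
        using IVT2[of h x 0 a] cont[of h h', OF h] \<open>h a > 0\<close> x by auto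
      then have "y < b" using x \<open>\<not> h x \<ge> 0\<close> by (cases "y = x") auto
      with y nz show False by auto
    qed
    \<comment> \<open>The Wronskian of the sine and \<open>h\<close>: the terms with
      \<open>h'\<close> cancel in its derivative. Since the sine vanishes at both ends,
      \<open>W a = - m * h a\<close> and \<open>W b = m * h b\<close>.\<close>
    define W where "W x = h' x * sin (m * (x - a)) - m * h x * cos (m * (x - a))" for x
    have "W a \<ge> W b"
    proof (rule DERIV_nonpos_imp_nonincreasing[where f = W])
      show "a \<le> b" using ab by simp
      fix x assume x: "a \<le> x" "x \<le> b"
      have "m * (x - a) \<le> m * (b - a)" using x m by simp
      then have "sin (m * (x - a)) \<ge> 0" using x m mb by (intro sin_ge_zero) auto
      moreover have "m\<^sup>2 - q x \<le> 0" using q x by (simp add: b_def)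
      ultimately have le: "(m\<^sup>2 - q x) * (h x * sin (m * (x - a))) \<le> 0"
        using nonneg[OF x] by (intro mult_nonpos_nonneg) auto
      have "(W has_real_derivative (m\<^sup>2 - q x) * (h x * sin (m * (x - a)))) (at x)"
        unfolding W_def
        by (rule derivative_eq_intros h h' refl)+ (simp add: algebra_simps power2_eq_square)
      with le show "\<exists>y. (W has_real_derivative y) (at x) \<and> y \<le> 0" by blast
    qed
    then have "m * (h a + h b) \<le> 0" by (simp add: W_def mb distrib_left)
    moreover have "h a + h b > 0" using nonneg[of b] ab \<open>h a > 0\<close> by simp
    ultimately show False using m by (simp add: mult_le_0_iff)
  qed
  have mg: "((\<lambda>x. - g x) has_real_derivative - g' x) (at x)"
    and mg': "((\<lambda>x. - g' x) has_real_derivative - q x * - g x) (at x)" for x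
    using DERIV_minus[OF g] DERIV_minus[OF g'] by auto
  show ?thesis
  proof (rule ccontr)
    assume "\<not> ?thesis"
    then have nz: "g x \<noteq> 0" if "a \<le> x" "x < b" for x using that by (auto simp: b_def)
    then have "g a > 0 \<or> - g a > 0" using ab by force
    then show False
      using pos[of g g', OF g g'] pos[of "\<lambda>x. - g x" "\<lambda>x. - g' x", OF mg mg'] nz by auto
  qed
qed

text \<open>The half-open intervals are disjoint and ordered, so points chosen from them increase
  strictly with the index and are distinct.\<close>

lemma card_ge_if_meets_consecutive_intervals:
  fixes S :: "real set"
  assumes "finite S" "d > 0"
    and "\<And>i. i < k \<Longrightarrow> \<exists>x\<in>S. x \<in> {a + real i * d..<a + real i * d + d}"
  shows "k \<le> card S"
proof -
  obtain z where z: "z i \<in> S" "a + real i * d \<le> z i" "z i < a + real i * d + d" if "i < k" for i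
    using assms(3) unfolding Bex_def atLeastLessThan_iff by metis
  have "z i < z j" if "i < j" "j < k" for i j
  proof -
    have "real i * d + d = real (Suc i) * d" by (simp add: algebra_simps)
    also have "\<dots> \<le> real j * d" using that assms(2) by (intro mult_right_mono) auto
    finally show ?thesis using z[of i] z[of j] that by linarith
  qed
  then have "inj_on z {..<k}"
    by (metis inj_onI lessThan_iff linorder_neqE_nat order.strict_implies_not_eq)
  then have "card (z ` {..<k}) = k" by (simp add: card_image)
  moreover have "z ` {..<k} \<subseteq> S" using z by auto
  ultimately show ?thesis using assms(1) card_mono by metis
qed

text \<open>The quotient of \<open>P\<close> by its leading power tends to
  \<open>lead_coeff P\<close>, hence eventually exceeds half of that positive limit.\<close>

lemma eventually_poly_exp_ge:
  fixes P :: "real poly"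
  assumes "lead_coeff P > 0"
  shows "eventually (\<lambda>x. poly P (exp x) \<ge> lead_coeff P / 2 * exp (real (degree P) * x)) at_top"
proof -
  have "((\<lambda>x. poly P x / x ^ degree P) \<longlongrightarrow> lead_coeff P) at_top"
    using poly_divide_tendsto_aux at_top_le_at_infinity tendsto_mono by blast
  then have "((\<lambda>x. poly P (exp x) / exp x ^ degree P) \<longlongrightarrow> lead_coeff P) at_top"
    by (rule filterlim_compose[OF _ exp_at_top])
  then have "eventually (\<lambda>x. poly P (exp x) / exp x ^ degree P > lead_coeff P / 2) at_top"
    using assms by (intro order_tendstoD(1)) auto
  then show ?thesis
    by eventually_elim (simp add: field_simps exp_of_nat_mult exp_of_nat2_mult)
qed

lemma has_real_derivative_Re_of_real:
  assumes "f holomorphic_on UNIV"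
  shows "((\<lambda>x. Re (f (of_real x))) has_real_derivative Re (deriv f (of_real x))) (at x)"
  by (rule has_field_derivative_Re has_vector_derivative_real_field)+
    (use assms holomorphic_derivI in blast)

lemma exp_coeff_of_real: "exp_coeff P (of_real x) = of_real (poly P (exp x))"
proof -
  have "poly (map_poly of_real P) (of_real y) = complex_of_real (poly P y)" for y
    by (induction P) (auto simp: map_poly_pCons)
  then show ?thesis by (simp add: exp_coeff_def exp_of_real)
qed

text \<open>A nonconstant entire function has finitely many zeros in the compact image of
  \<open>closure I\<close>; a nonzero constant has none.\<close>

lemma finite_real_zeros:
  assumes "f holomorphic_on UNIV" "f \<noteq> (\<lambda>z. 0)" "bounded I"
  shows "finite {x \<in> I. f (of_real x) = 0}"
proof -
  have "compact (complex_of_real ` closure I)"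
    using assms(3) by (intro compact_continuous_image continuous_intros) (simp add: compact_closure)
  then have "finite {z \<in> complex_of_real ` closure I. f z = 0}"
  proof (cases "f constant_on UNIV")
    case True
    then have "f z \<noteq> 0" for z using assms(2) by (auto simp: constant_on_def)
    then show ?thesis by simp
  next
    case False
    with \<open>compact _\<close> assms(1) show ?thesis
      by (intro holomorphic_compact_finite_zeros[of f UNIV]) auto
  qed
  moreover have "of_real ` {x \<in> I. f (of_real x) = 0} \<subseteq> {z \<in> complex_of_real ` closure I. f z = 0}"
    using closure_subset by auto
  ultimately have "finite (complex_of_real ` {x \<in> I. f (of_real x) = 0})"
    using finite_subset by blast
  then show ?thesis by (rule finite_imageD) (simp add: inj_on_def)
qed

theorem theorem13:
  fixes P :: "real poly" and f :: "complex \<Rightarrow> complex"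
  assumes "lead_coeff P > 0"
    and "real_solution (exp_coeff P) f"
    and "f \<noteq> (\<lambda>z. 0)"
  shows "\<exists>C>0. eventually
           (\<lambda>r::real. real (zero_count {0..<r} f) \<ge> C * exp (real (degree P) * r / 2)) at_top"
proof -
  define n where "n = real (degree P)"
  \<comment> \<open>\<open>c\<^sup>2\<close> is the factor in the eventual lower bound for
    \<open>P\<close>; \<open>C\<close> is half of \<open>m * L / pi\<close>, for the
    \<open>m\<close> chosen below, with \<open>exp (n * r / 2)\<close> split off.\<close>
  define c where "c = sqrt (lead_coeff P / 2)"
  define L where "L = pi / c"
  define C where "C = c * exp (- n * L / 2) * L / (2 * pi)"
  have c: "c > 0" "c\<^sup>2 = lead_coeff P / 2" using assms(1) by (simp_all add: c_def)
  have L: "L > 0" "c * L = pi" using c by (simp_all add: L_def)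
  have n: "n \<ge> 0" by (simp add: n_def)
  have hol: "f holomorphic_on UNIV" and ode: "\<And>z. deriv (deriv f) z = - exp_coeff P z * f z"
    and real: "\<And>x::real. f (of_real x) \<in> \<real>"
    using assms(2) by (auto simp: real_solution_def ode_solution_def add_eq_0_iff)
  \<comment> \<open>As \<open>f\<close> is real on the real axis, \<open>g\<close> has exactly its
    real zeros and solves the real equation.\<close>
  define g where "g x = Re (f (of_real x))" for x
  define g' where "g' x = Re (deriv f (of_real x))" for x
  have zero_iff: "f (of_real x) = 0 \<longleftrightarrow> g x = 0" for x
    using real[of x] by (auto simp: g_def complex_eq_iff complex_is_Real_iff)
  have dg: "(g has_real_derivative g' x) (at x)" for x
    unfolding g_def g'_def using has_real_derivative_Re_of_real[OF hol] .
  have dg': "(g' has_real_derivative - poly P (exp x) * g x) (at x)" for x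
    using has_real_derivative_Re_of_real[OF holomorphic_deriv[OF hol open_UNIV]]
    by (simp add: g_def g'_def[abs_def] ode exp_coeff_of_real)
  obtain R where R: "\<And>x. x \<ge> R \<Longrightarrow> c\<^sup>2 * exp (n * x) \<le> poly P (exp x)"
    using eventually_poly_exp_ge[OF assms(1)] by (auto simp: eventually_at_top_linorder c n_def)
  have bound: "real (zero_count {0..<r} f) \<ge> C * exp (n * r / 2)"
    \<comment> \<open>This puts \<open>[r - L, r)\<close> inside \<open>[0, r)\<close> and to the
      right of \<open>R\<close>.\<close>
    if r: "r \<ge> max 0 R + L" for r
  proof -
    \<comment> \<open>\<open>m\<^sup>2\<close> is the lower bound for the coefficient at the left
      end \<open>r - L\<close>; as \<open>n \<ge> 0\<close>, it persists to the right.\<close>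
    define m where "m = c * exp (n * (r - L) / 2)"
    define k where "k = nat \<lfloor>m * L / pi\<rfloor>"
    have rL: "0 \<le> r - L" "R \<le> r - L" using r by auto
    have m: "m > 0" using c by (simp add: m_def)
    have "1 \<le> exp (n * (r - L) / 2)" using n rL by simp
    then have "c * L \<le> m * L" using c(1) L(1) by (simp only: m_def) simp
    then have one: "1 \<le> m * L / pi" using L(2) by (simp add: pos_le_divide_eq)
    \<comment> \<open>With \<open>k \<ge> 1\<close>, rounding down gives
      \<open>m * L / pi < k + 1 \<le> 2 * k\<close>.\<close>
    have "1 \<le> \<lfloor>m * L / pi\<rfloor>" using one by linarith
    then have "real k = of_int \<lfloor>m * L / pi\<rfloor>" "1 \<le> real k"
      unfolding k_def by linarith+
    then have k_le: "real k \<le> m * L / pi" and k_ge: "m * L / pi \<le> 2 * real k"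
      by linarith+
    have zeros: "\<exists>x\<in>{x \<in> {0..<r}. f (of_real x) = 0}.
        x \<in> {(r - L) + real i * (pi / m)..<(r - L) + real i * (pi / m) + pi / m}"
      if "i < k" for i
    proof -
      define a where "a = (r - L) + real i * (pi / m)"
      have a: "r - L \<le> a" using m by (simp add: a_def)
      \<comment> \<open>The right end of interval \<open>i\<close> stays within \<open>r\<close>,
        because \<open>Suc i \<le> k\<close> and \<open>k\<close> intervals of length
        \<open>pi / m\<close> fit into length \<open>L\<close>.\<close>
      have "real (Suc i) * (pi / m) \<le> m * L / pi * (pi / m)"
        using that k_le m by (intro mult_right_mono) auto
      also have "\<dots> = L" using m by simp
      finally have b: "a + pi / m \<le> r" by (simp add: a_def algebra_simps add_divide_distrib)
      have "\<exists>x\<in>{a..<a + pi / m}. g x = 0"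
      proof (rule sturm_comparison_zero[OF m dg dg'])
        fix x assume x: "a \<le> x" "x \<le> a + pi / m"
        have "m\<^sup>2 = c\<^sup>2 * exp (n * (r - L))"
          by (simp add: m_def power_mult_distrib flip: exp_double)
        also have "\<dots> \<le> c\<^sup>2 * exp (n * x)"
          using n a x by (intro mult_left_mono) (auto intro: mult_left_mono)
        also have "\<dots> \<le> poly P (exp x)" using R rL a x by auto
        finally show "m\<^sup>2 \<le> poly P (exp x)" .
      qed
      then obtain x where "a \<le> x" "x < a + pi / m" "g x = 0" by auto
      then show ?thesis
        unfolding a_def[symmetric] using a b rL by (intro bexI[of _ x]) (auto simp: zero_iff)
    qed
    have "n * (r - L) / 2 = - n * L / 2 + n * r / 2" by (simp add: algebra_simps diff_divide_distrib)
    then have "C * exp (n * r / 2) = m * L / pi / 2"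
      unfolding C_def m_def by (simp only: exp_add) (simp add: ac_simps)
    also have "\<dots> \<le> real k" using divide_right_mono[OF k_ge, of 2] by simp
    also have "k \<le> zero_count {0..<r} f"
      unfolding zero_count_def
    proof (rule card_ge_if_meets_consecutive_intervals[OF _ _ zeros])
      show "finite {x \<in> {0..<r}. f (of_real x) = 0}"
        by (rule finite_real_zeros[OF hol assms(3)]) simp
    qed (use m in auto)
    finally show ?thesis by simp
  qed
  have "C > 0" using c L by (simp add: C_def)
  moreover have "eventually (\<lambda>r. real (zero_count {0..<r} f) \<ge> C * exp (n * r / 2)) at_top"
    using eventually_ge_at_top[of "max 0 R + L"] by eventually_elim (rule bound)
  ultimately show ?thesis unfolding n_def by blast
qed

end
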